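(* Let $T>0$ and let $(\mathbf{X},\kappa,\lambda,\eta)$, with $\mathbf{X}:\mathbb{I}\times[0,T]\to\mathbb{R}^2$, $\kappa:\mathbb{I}\times[0,T]\to\mathbb{R}$ and $\lambda,\eta:[0,T]\to\mathbb{R}$, be a solution of the system \begin{align*} \partial_t\mathbf{X}\cdot\mathbf{n}&=\partial_{ss}\kappa+\lambda(t)\,\kappa+\eta(t),\\ \kappa\,\mathbf{n}&=-\partial_{ss}\mathbf{X},\\ \frac{\mathrm{d}L}{\mathrm{d}t}&=-\int_{\Gamma(t)}|\partial_s\kappa|^2\,\mathrm{d}s,\\ \frac{\mathrm{d}A}{\mathrm{d}t}&=0, \end{align*} where $\Gamma(t)=\mathbf{X}(\mathbb{I},t)$ is a closed $C^2$-curve, and $L(t)$ and $A(t)$ are the perimeter and the area of $\Gamma(t)$. Then for every time $t$ at which $\kappa(\cdot,t)$ is not constant with respect to the spatial variable, one has $\lambda(t)=\eta(t)=0$.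
   Context: $\mathbb{I}=\mathbb{R}/\mathbb{Z}$ is the periodic unit interval $[0,1]$. For each $t$, $\mathbf{X}(\cdot,t):\mathbb{I}\to\mathbb{R}^2$ is a regular parametrization ($|\partial_\rho\mathbf{X}|>0$) of a simple closed curve $\Gamma(t)$; functions on $\Gamma(t)$ are identified with functions of $\rho\in\mathbb{I}$. The arc-length derivative is $\partial_s f=\partial_\rho f/|\partial_\rho\mathbf{X}|$, $\partial_{ss}=\partial_s\partial_s$, and $\int_{\Gamma(t)}f\,\mathrm{d}s=\int_{\mathbb{I}}f\,|\partial_\rho\mathbf{X}|\,\mathrm{d}\rho$. The unit normal is $\mathbf{n}=-(\partial_s\mathbf{X})^\perp$, where $(\cdot)^\perp$ is clockwise rotation by $\pi/2$, i.e. $(a,b)^\perp=(b,-a)$. The perimeter and area are $$L(t)=\int_{\mathbb{I}}|\partial_\rho\mathbf{X}|\,\mathrm{d}\rho,\qquad A(t)=\frac12\int_{\Gamma(t)}\mathbf{X}\cdot\mathbf{n}\,\mathrm{d}s=-\frac12\int_{\mathbb{I}}\mathbf{X}\cdot(\partial_\rho\mathbf{X})^\perp\,\mathrm{d}\rho .$$ "Solution" is understood in the classical sense: $\mathbf{X}$ and $\kappa$ are smooth enough that all derivatives appearing in the system, and the mixed derivative $\partial_t\partial_\rho\mathbf{X}=\partial_\rho\partial_t\mathbf{X}$, exist and are continuous, and the equations hold pointwise. *)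

theory Defs
  imports "HOL-Analysis.Analysis"
begin

text \<open>
  Functions on the periodic interval R/Z are represented by 1-periodic functions on the whole
  real line; a time-dependent function is written \<open>f \<rho> t\<close>, and only its values for
  \<open>t \<in> {0..T}\<close> matter.
\<close>

definition periodic1 :: "(real \<Rightarrow> 'a) \<Rightarrow> bool" where
  "periodic1 f \<longleftrightarrow> (\<forall>\<rho>. f (\<rho> + 1) = f \<rho>)"

definition d_rho :: "(real \<Rightarrow> real \<Rightarrow> 'a::real_normed_vector) \<Rightarrow> real \<Rightarrow> real \<Rightarrow> 'a" where
  "d_rho f \<rho> t = vector_derivative (\<lambda>r. f r t) (at \<rho>)"

text \<open>The time derivative is one-sided at \<open>t = 0\<close> and \<open>t = T\<close>.\<close>

definition d_t :: "real \<Rightarrow> (real \<Rightarrow> real \<Rightarrow> 'a::real_normed_vector) \<Rightarrow> real \<Rightarrow> real \<Rightarrow> 'a" where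
  "d_t T f \<rho> t = vector_derivative (\<lambda>s. f \<rho> s) (at t within {0..T})"

text \<open>
  \<open>vector_derivative\<close> is total, so existence of the derivatives is required separately, together
  with joint continuity in \<open>(\<rho>, t)\<close>.
\<close>

definition C1_rho :: "real \<Rightarrow> (real \<Rightarrow> real \<Rightarrow> 'a::real_normed_vector) \<Rightarrow> bool" where
  "C1_rho T f \<longleftrightarrow>
     (\<forall>\<rho>. \<forall>t\<in>{0..T}. (\<lambda>r. f r t) differentiable (at \<rho>)) \<and>
     continuous_on (UNIV \<times> {0..T}) (\<lambda>(\<rho>, t). d_rho f \<rho> t)"

definition C1_t :: "real \<Rightarrow> (real \<Rightarrow> real \<Rightarrow> 'a::real_normed_vector) \<Rightarrow> bool" where
  "C1_t T f \<longleftrightarrow>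
     (\<forall>\<rho>. \<forall>t\<in>{0..T}. (\<lambda>s. f \<rho> s) differentiable (at t within {0..T})) \<and>
     continuous_on (UNIV \<times> {0..T}) (\<lambda>(\<rho>, t). d_t T f \<rho> t)"

definition d_s :: "(real \<Rightarrow> real \<Rightarrow> real^2) \<Rightarrow> (real \<Rightarrow> real \<Rightarrow> 'a::real_normed_vector)
    \<Rightarrow> real \<Rightarrow> real \<Rightarrow> 'a" where
  "d_s X f \<rho> t = d_rho f \<rho> t /\<^sub>R norm (d_rho X \<rho> t)"

definition d_ss :: "(real \<Rightarrow> real \<Rightarrow> real^2) \<Rightarrow> (real \<Rightarrow> real \<Rightarrow> 'a::real_normed_vector)
    \<Rightarrow> real \<Rightarrow> real \<Rightarrow> 'a" where
  "d_ss X f = d_s X (d_s X f)"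

definition curve_integral :: "(real \<Rightarrow> real \<Rightarrow> real^2) \<Rightarrow> (real \<Rightarrow> real \<Rightarrow> real) \<Rightarrow> real \<Rightarrow> real" where
  "curve_integral X f t = integral {0..1} (\<lambda>\<rho>. f \<rho> t * norm (d_rho X \<rho> t))"

text \<open>Clockwise rotation by \<open>\<pi>/2\<close>.\<close>

definition perp :: "real^2 \<Rightarrow> real^2" where
  "perp v = vector [v $ 2, - (v $ 1)]"

definition unit_normal :: "(real \<Rightarrow> real \<Rightarrow> real^2) \<Rightarrow> real \<Rightarrow> real \<Rightarrow> real^2" where
  "unit_normal X \<rho> t = - perp (d_s X X \<rho> t)"

definition perimeter :: "(real \<Rightarrow> real \<Rightarrow> real^2) \<Rightarrow> real \<Rightarrow> real" where
  "perimeter X t = integral {0..1} (\<lambda>\<rho>. norm (d_rho X \<rho> t))"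

text \<open>The orientation of the parametrization is not prescribed, so this area carries a sign.\<close>

definition area :: "(real \<Rightarrow> real \<Rightarrow> real^2) \<Rightarrow> real \<Rightarrow> real" where
  "area X t = 1/2 * curve_integral X (\<lambda>\<rho> t. X \<rho> t \<bullet> unit_normal X \<rho> t) t"

text \<open>
  Being a closed \<open>C\<^sup>2\<close>-curve is a property of the point set: the parametrization \<open>\<gamma>\<close> witnessing
  it need not be the one given by \<open>X\<close>.
\<close>

definition simple_closed_C2_curve :: "(real^2) set \<Rightarrow> bool" where
  "simple_closed_C2_curve G \<longleftrightarrow>
     (\<exists>\<gamma> \<gamma>' \<gamma>''. periodic1 \<gamma> \<and> inj_on \<gamma> {0..<1} \<and> range \<gamma> = G \<and>
        (\<forall>\<rho>. (\<gamma> has_vector_derivative \<gamma>' \<rho>) (at \<rho>)) \<and>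
        (\<forall>\<rho>. (\<gamma>' has_vector_derivative \<gamma>'' \<rho>) (at \<rho>)) \<and>
        continuous_on UNIV \<gamma>'' \<and> (\<forall>\<rho>. \<gamma>' \<rho> \<noteq> 0))"

definition evolving_closed_curve :: "real \<Rightarrow> (real \<Rightarrow> real \<Rightarrow> real^2) \<Rightarrow> bool" where
  "evolving_closed_curve T X \<longleftrightarrow>
     (\<forall>t\<in>{0..T}. periodic1 (\<lambda>\<rho>. X \<rho> t) \<and> inj_on (\<lambda>\<rho>. X \<rho> t) {0..<1} \<and>
        (\<forall>\<rho>. norm (d_rho X \<rho> t) > 0) \<and>
        simple_closed_C2_curve (range (\<lambda>\<rho>. X \<rho> t)))"

text \<open>
  Since \<open>\<partial>\<^sub>s\<close> is \<open>\<partial>\<^sub>\<rho>\<close> divided by the positive continuous function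
  \<open>norm (d_rho X \<rho> t)\<close>, existence and continuity of arc-length derivatives is expressed by
  \<open>C1_rho\<close>.
\<close>

definition classical_regularity ::
    "real \<Rightarrow> (real \<Rightarrow> real \<Rightarrow> real^2) \<Rightarrow> (real \<Rightarrow> real \<Rightarrow> real) \<Rightarrow> bool" where
  "classical_regularity T X \<kappa> \<longleftrightarrow>
     C1_t T X \<and> C1_rho T X \<and> C1_rho T (d_s X X) \<and>
     C1_t T (d_rho X) \<and> C1_rho T (d_t T X) \<and>
     (\<forall>\<rho>. \<forall>t\<in>{0..T}. d_t T (d_rho X) \<rho> t = d_rho (d_t T X) \<rho> t) \<and>
     C1_rho T \<kappa> \<and> C1_rho T (d_s X \<kappa>)"

definition classical_solution ::
    "real \<Rightarrow> (real \<Rightarrow> real \<Rightarrow> real^2) \<Rightarrow> (real \<Rightarrow> real \<Rightarrow> real)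
      \<Rightarrow> (real \<Rightarrow> real) \<Rightarrow> (real \<Rightarrow> real) \<Rightarrow> bool" where
  "classical_solution T X \<kappa> \<mu> \<eta> \<longleftrightarrow>
     evolving_closed_curve T X \<and>
     (\<forall>t\<in>{0..T}. periodic1 (\<lambda>\<rho>. \<kappa> \<rho> t)) \<and>
     classical_regularity T X \<kappa> \<and>
     (\<forall>\<rho>. \<forall>t\<in>{0..T}.
        d_t T X \<rho> t \<bullet> unit_normal X \<rho> t = d_ss X \<kappa> \<rho> t + \<mu> t * \<kappa> \<rho> t + \<eta> t) \<and>
     (\<forall>\<rho>. \<forall>t\<in>{0..T}. \<kappa> \<rho> t *\<^sub>R unit_normal X \<rho> t = - d_ss X X \<rho> t) \<and>
     (\<forall>t\<in>{0..T}. (perimeter X has_real_derivative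
        - curve_integral X (\<lambda>\<rho> t. \<bar>d_s X \<kappa> \<rho> t\<bar>\<^sup>2) t) (at t within {0..T})) \<and>
     (\<forall>t\<in>{0..T}. (area X has_real_derivative 0) (at t within {0..T}))"

end

theory Submission
  imports Defs
begin

text \<open>
  Put \<open>w = \<mu> \<kappa> + \<eta>\<close>, so that the normal velocity is \<open>V = \<kappa>\<^sub>s\<^sub>s + w\<close>. The first variations of length
  and area are \<open>L' = \<integral> \<kappa> V ds\<close> and \<open>A' = \<integral> V ds\<close>. As \<open>\<integral> \<kappa> \<kappa>\<^sub>s\<^sub>s ds = - \<integral> \<kappa>\<^sub>s\<^sup>2 ds\<close> and
  \<open>\<integral> \<kappa>\<^sub>s\<^sub>s ds = 0\<close> on a closed curve, the prescribed rates of change say that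
  \<open>\<integral> \<kappa> w ds = 0\<close> and \<open>\<integral> w ds = 0\<close>. Hence \<open>\<integral> w\<^sup>2 ds = 0\<close>, so \<open>\<mu> \<kappa> + \<eta>\<close> vanishes identically,
  which for nonconstant \<open>\<kappa>\<close> forces \<open>\<mu> = \<eta> = 0\<close>.
\<close>

section \<open>Periodic functions and parametrized derivatives\<close>

lemma periodic1_of_int:
  fixes f :: "real \<Rightarrow> 'a"
  assumes "periodic1 f"
  shows "f (x + of_int k) = f x"
proof -
  interpret periodic_fun_simple f 1
    using assms by unfold_locales (simp add: periodic1_def)
  show ?thesis using plus_of_int[of x k] by simp
qed

lemma periodic1_frac:
  fixes f :: "real \<Rightarrow> 'a"
  assumes "periodic1 f"
  shows "f (frac x) = f x"
  using periodic1_of_int[OF assms, of "frac x" "\<lfloor>x\<rfloor>"] by (simp add: frac_def)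

text \<open>The boundary terms of the fundamental theorem of calculus cancel over one period.
  Applied to products of periodic functions, this is integration by parts on the closed
  curve.\<close>

lemma periodic1_has_integral_derivative:
  fixes f :: "real \<Rightarrow> 'a::banach"
  assumes "periodic1 f" and "\<And>x. (f has_vector_derivative f' x) (at x)"
  shows "(f' has_integral 0) {0..1}"
proof -
  have "(f' has_integral (f 1 - f 0)) {0..1}"
    by (rule fundamental_theorem_of_calculus)
       (auto intro: has_vector_derivative_at_within assms(2))
  moreover have "f 1 = f 0"
    using assms(1) unfolding periodic1_def by (metis add_0)
  ultimately show ?thesis by simp
qed

text \<open>No differentiability is assumed: \<open>vector_derivative\<close> chooses among the
  admissible derivatives, and translation by a period leaves the set of candidates
  unchanged.\<close>

lemma periodic1_d_rho:
  assumes "periodic1 (\<lambda>\<rho>. f \<rho> t)"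
  shows "periodic1 (\<lambda>\<rho>. d_rho f \<rho> t)"
proof -
  have "(\<lambda>r. f (r + 1) t) = (\<lambda>r. f r t)"
    using assms by (auto simp: periodic1_def)
  moreover have "((\<lambda>r. f r t) has_vector_derivative D) (at (\<rho> + 1)) \<longleftrightarrow>
      ((\<lambda>r. f (r + 1) t) has_vector_derivative D) (at \<rho>)" for \<rho> D
    by (simp add: has_vector_derivative_def has_derivative_at ac_simps)
  ultimately show ?thesis
    by (simp add: periodic1_def d_rho_def vector_derivative_def)
qed

lemma periodic1_d_s:
  assumes "periodic1 (\<lambda>\<rho>. X \<rho> t)" and "periodic1 (\<lambda>\<rho>. f \<rho> t)"
  shows "periodic1 (\<lambda>\<rho>. d_s X f \<rho> t)"
  using periodic1_d_rho[of X t, OF assms(1)] periodic1_d_rho[of f t, OF assms(2)]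
  by (simp add: periodic1_def d_s_def)

text \<open>The functions of time at \<open>\<rho>\<close> and \<open>\<rho> + 1\<close> are known
  to agree only on \<open>{0..T}\<close>; this is enough because the derivative is taken within that
  set.\<close>

lemma periodic1_d_t:
  assumes "\<And>s. s \<in> {0..T} \<Longrightarrow> periodic1 (\<lambda>\<rho>. f \<rho> s)" and "t \<in> {0..T}"
  shows "periodic1 (\<lambda>\<rho>. d_t T f \<rho> t)"
proof -
  have "((\<lambda>s. f (\<rho> + 1) s) has_vector_derivative D) (at t within {0..T}) \<longleftrightarrow>
      ((\<lambda>s. f \<rho> s) has_vector_derivative D) (at t within {0..T})" for \<rho> D
    using assms by (intro has_vector_derivative_cong_ev) (auto simp: periodic1_def)
  then show ?thesis
    by (simp add: periodic1_def d_t_def vector_derivative_def)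
qed

lemma C1_rho_has_vector_derivative:
  assumes "C1_rho T f" and "t \<in> {0..T}"
  shows "((\<lambda>r. f r t) has_vector_derivative d_rho f \<rho> t) (at \<rho>)"
  using assms by (simp add: C1_rho_def d_rho_def vector_derivative_works)

lemma C1_rho_continuous:
  assumes "C1_rho T f" and "t \<in> {0..T}"
  shows "continuous_on S (\<lambda>\<rho>. f \<rho> t)"
  using C1_rho_has_vector_derivative[OF assms]
  by (meson continuous_at_imp_continuous_on has_vector_derivative_continuous)

lemma C1_rho_continuous_d_rho:
  assumes "C1_rho T f" and "t \<in> {0..T}"
  shows "continuous_on S (\<lambda>\<rho>. d_rho f \<rho> t)"
proof -
  have "continuous_on (UNIV \<times> {0..T}) (\<lambda>(\<rho>, t). d_rho f \<rho> t)"
    using assms by (simp add: C1_rho_def)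
  moreover have "continuous_on S (\<lambda>\<rho>. (\<rho>, t))"
    by (intro continuous_intros)
  ultimately have "continuous_on S (\<lambda>\<rho>. (\<lambda>(\<rho>, t). d_rho f \<rho> t) (\<rho>, t))"
    by (rule continuous_on_compose2) (use assms(2) in auto)
  then show ?thesis by simp
qed

lemma C1_t_has_vector_derivative:
  assumes "C1_t T f" and "t \<in> {0..T}"
  shows "((\<lambda>s. f \<rho> s) has_vector_derivative d_t T f \<rho> t) (at t within {0..T})"
  using assms by (simp add: C1_t_def d_t_def vector_derivative_works)

text \<open>Existence of both partial derivatives alone gives only separate continuity. Joint
  continuity of the time derivative upgrades this to total differentiability on the strip, hence to
  continuity. The area integrand contains \<open>X\<close> itself and needs this.\<close>

lemma C1_imp_jointly_continuous:
  assumes "C1_rho T f" and "C1_t T f"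
  shows "continuous_on (UNIV \<times> {0..T}) (\<lambda>(\<rho>, t). f \<rho> t)"
proof -
  have "continuous (at (\<rho>, t) within UNIV \<times> {0..T}) (\<lambda>(\<rho>, t). f \<rho> t)" if t: "t \<in> {0..T}" for \<rho> t
  proof (rule has_derivative_continuous, rule has_derivative_partialsI)
    show "((\<lambda>r. f r t) has_derivative (\<lambda>h. h *\<^sub>R d_rho f \<rho> t)) (at \<rho>)"
      using C1_rho_has_vector_derivative[OF assms(1) t] by (simp add: has_vector_derivative_def)
    show "((\<lambda>s. f r s) has_derivative blinfun_apply (blinfun_scaleR_left (d_t T f r s)))
        (at s within {0..T})" if "s \<in> {0..T}" for r s
      using C1_t_has_vector_derivative[OF assms(2) that] by (simp add: has_vector_derivative_def)
    have "continuous_on (UNIV \<times> {0..T}) (\<lambda>(\<rho>, t). d_t T f \<rho> t)"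
      using assms(2) by (simp add: C1_t_def)
    then have "continuous_on (UNIV \<times> {0..T}) (\<lambda>(\<rho>, t). blinfun_scaleR_left (d_t T f \<rho> t))"
      by (auto intro!: continuous_intros simp: case_prod_unfold)
    then show "continuous (at (\<rho>, t) within UNIV \<times> {0..T})
        (\<lambda>(\<rho>, t). blinfun_scaleR_left (d_t T f \<rho> t))"
      using t by (simp add: continuous_on_eq_continuous_within)
  qed (use t in auto)
  then show ?thesis
    by (auto simp: continuous_on_eq_continuous_within)
qed

lemma has_real_derivative_integral_parameter:
  fixes f f' :: "real \<Rightarrow> real \<Rightarrow> real"
  assumes "\<And>\<rho> s. s \<in> {0..T} \<Longrightarrow> ((\<lambda>s. f \<rho> s) has_real_derivative f' \<rho> s) (at s within {0..T})"
    and "\<And>s. s \<in> {0..T} \<Longrightarrow> continuous_on {0..1} (\<lambda>\<rho>. f \<rho> s)"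
    and "continuous_on (UNIV \<times> {0..T}) (\<lambda>(\<rho>, s). f' \<rho> s)"
    and "t \<in> {0..T}"
  shows "((\<lambda>s. integral {0..1} (\<lambda>\<rho>. f \<rho> s)) has_real_derivative integral {0..1} (\<lambda>\<rho>. f' \<rho> t))
    (at t within {0..T})"
proof -
  \<comment> \<open>The Leibniz rule expects the parameter as first argument, so the two variables
    are exchanged.\<close>
  have "continuous_on ({0..T} \<times> cbox 0 1) (\<lambda>p. (\<lambda>(\<rho>, s). f' \<rho> s) (prod.swap p))"
    by (rule continuous_on_compose2[OF assms(3) continuous_on_swap]) auto
  then have "continuous_on ({0..T} \<times> cbox 0 1) (\<lambda>(s, \<rho>). f' \<rho> s)"
    by (simp add: case_prod_unfold)
  from leibniz_rule_field_derivative[OF _ _ this, where f="\<lambda>s \<rho>. f \<rho> s" and ?x0.0=t] show ?thesis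
    using assms(1,2,4) by (simp add: integrable_continuous_interval)
qed

section \<open>First variation of length and area\<close>

lemma inner_perp: "u \<bullet> perp v = u $ 1 * v $ 2 - u $ 2 * v $ 1"
  by (simp add: perp_def inner_vec_def sum_2)

lemma inner_perp_commute: "u \<bullet> perp v = - (v \<bullet> perp u)"
  by (simp add: inner_perp)

lemma bounded_linear_perp: "bounded_linear perp"
  unfolding linear_conv_bounded_linear[symmetric]
  by (rule linearI) (simp_all add: perp_def vec_eq_iff forall_2)

lemmas continuous_on_perp [continuous_intros] =
  bounded_linear.continuous_on[OF bounded_linear_perp]

lemma has_vector_derivative_inner:
  assumes "(f has_vector_derivative f') (at x within S)"
    and "(g has_vector_derivative g') (at x within S)"
  shows "((\<lambda>x. f x \<bullet> g x) has_vector_derivative (f x \<bullet> g' + f' \<bullet> g x)) (at x within S)"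
  by (rule bounded_bilinear.has_vector_derivative[OF bounded_bilinear_inner assms])

lemma has_vector_derivative_inner_perp:
  assumes "(f has_vector_derivative f') (at x within S)"
    and "(g has_vector_derivative g') (at x within S)"
  shows "((\<lambda>x. f x \<bullet> perp (g x)) has_vector_derivative (f x \<bullet> perp g' + f' \<bullet> perp (g x)))
    (at x within S)"
  by (intro has_vector_derivative_inner assms(1)
      bounded_linear.has_vector_derivative[OF bounded_linear_perp assms(2)])

text \<open>The direction of \<open>f x\<close> is written as a quotient so that it becomes the unit
  tangent \<open>d_s X X\<close> when \<open>f\<close> is \<open>d_rho X\<close> as a function of
  time.\<close>

lemma has_real_derivative_norm:
  fixes f :: "real \<Rightarrow> 'a::real_inner"
  assumes "(f has_vector_derivative f') (at x within S)" and "f x \<noteq> 0"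
  shows "((\<lambda>x. norm (f x)) has_real_derivative (f x /\<^sub>R norm (f x)) \<bullet> f') (at x within S)"
proof -
  have "((\<lambda>x. norm (f x)) has_derivative (\<lambda>h. (h *\<^sub>R f') \<bullet> sgn (f x))) (at x within S)"
    using has_derivative_compose[OF assms(1)[unfolded has_vector_derivative_def]
        has_derivative_norm[OF assms(2)]] by simp
  moreover have "(\<lambda>h. (h *\<^sub>R f') \<bullet> sgn (f x)) = (*) ((f x /\<^sub>R norm (f x)) \<bullet> f')"
    by (simp add: fun_eq_iff sgn_div_norm inner_commute)
  ultimately show ?thesis
    by (simp add: has_field_derivative_def)
qed

text \<open>The speed changes at the rate tangent times \<open>d_t T (d_rho X)\<close>. Exchanging
  the mixed derivatives and integrating by parts moves the spatial derivative from the velocity onto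
  the tangent, where the curvature equation can be inserted.\<close>

lemma perimeter_has_real_derivative:
  assumes reg: "classical_regularity T X \<kappa>"
    and per: "\<And>s. s \<in> {0..T} \<Longrightarrow> periodic1 (\<lambda>\<rho>. X \<rho> s)"
    and pos: "\<And>\<rho> s. s \<in> {0..T} \<Longrightarrow> d_rho X \<rho> s \<noteq> 0"
    and t: "t \<in> {0..T}"
  shows "(perimeter X has_real_derivative
    - integral {0..1} (\<lambda>\<rho>. d_rho (d_s X X) \<rho> t \<bullet> d_t T X \<rho> t)) (at t within {0..T})"
proof -
  have C: "C1_rho T X" "C1_rho T (d_s X X)" "C1_t T (d_rho X)" "C1_rho T (d_t T X)"
    and mixed: "\<And>\<rho> s. s \<in> {0..T} \<Longrightarrow> d_t T (d_rho X) \<rho> s = d_rho (d_t T X) \<rho> s"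
    using reg by (auto simp: classical_regularity_def)
  have J: "continuous_on (UNIV \<times> {0..T}) (\<lambda>(\<rho>, s). d_rho X \<rho> s)"
    "continuous_on (UNIV \<times> {0..T}) (\<lambda>(\<rho>, s). d_rho (d_t T X) \<rho> s)"
    using C by (auto simp: C1_rho_def)
  have D: "(perimeter X has_real_derivative
      integral {0..1} (\<lambda>\<rho>. d_s X X \<rho> t \<bullet> d_rho (d_t T X) \<rho> t)) (at t within {0..T})"
    unfolding perimeter_def [abs_def]
  proof (rule has_real_derivative_integral_parameter)
    show "((\<lambda>s. norm (d_rho X \<rho> s)) has_real_derivative d_s X X \<rho> s \<bullet> d_rho (d_t T X) \<rho> s)
        (at s within {0..T})" if "s \<in> {0..T}" for \<rho> s
      using has_real_derivative_norm[OF C1_t_has_vector_derivative[OF C(3) that] pos[OF that]]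
      by (simp add: mixed[OF that] d_s_def)
    show "continuous_on {0..1} (\<lambda>\<rho>. norm (d_rho X \<rho> s))" if "s \<in> {0..T}" for s
      by (intro continuous_intros C1_rho_continuous_d_rho[OF C(1) that])
    show "continuous_on (UNIV \<times> {0..T}) (\<lambda>(\<rho>, s). d_s X X \<rho> s \<bullet> d_rho (d_t T X) \<rho> s)"
      using J pos unfolding d_s_def case_prod_unfold by (intro continuous_intros) auto
  qed (rule t)
  have "periodic1 (\<lambda>\<rho>. d_s X X \<rho> t \<bullet> d_t T X \<rho> t)"
    using periodic1_d_s[of X t X, OF per[OF t] per[OF t]] periodic1_d_t[of T X t, OF per t]
    by (simp add: periodic1_def)
  then have "((\<lambda>\<rho>. d_s X X \<rho> t \<bullet> d_rho (d_t T X) \<rho> t + d_rho (d_s X X) \<rho> t \<bullet> d_t T X \<rho> t)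
      has_integral 0) {0..1}"
    by (rule periodic1_has_integral_derivative)
       (intro has_vector_derivative_inner C1_rho_has_vector_derivative[OF _ t] C)
  moreover have "(\<lambda>\<rho>. d_rho (d_s X X) \<rho> t \<bullet> d_t T X \<rho> t) integrable_on {0..1}"
    by (intro integrable_continuous_interval continuous_intros
        C1_rho_continuous_d_rho[OF _ t] C1_rho_continuous[OF _ t] C)
  from has_integral_diff[OF calculation integrable_integral[OF this]]
  have "((\<lambda>\<rho>. d_s X X \<rho> t \<bullet> d_rho (d_t T X) \<rho> t) has_integral
      - integral {0..1} (\<lambda>\<rho>. d_rho (d_s X X) \<rho> t \<bullet> d_t T X \<rho> t)) {0..1}"
    by simp
  with D show ?thesis
    by (simp add: integral_unique)
qed

text \<open>Differentiating the bilinear area integrand gives two terms. Integration by parts and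
  the antisymmetry of \<open>u \<bullet> perp v\<close> show that their integrals agree, which
  absorbs the factor \<open>1/2\<close>.\<close>

lemma area_has_real_derivative:
  assumes reg: "classical_regularity T X \<kappa>"
    and per: "\<And>s. s \<in> {0..T} \<Longrightarrow> periodic1 (\<lambda>\<rho>. X \<rho> s)"
    and pos: "\<And>\<rho> s. s \<in> {0..T} \<Longrightarrow> d_rho X \<rho> s \<noteq> 0"
    and t: "t \<in> {0..T}"
  shows "(area X has_real_derivative
    curve_integral X (\<lambda>\<rho> t. d_t T X \<rho> t \<bullet> unit_normal X \<rho> t) t) (at t within {0..T})"
proof -
  have C: "C1_t T X" "C1_rho T X" "C1_t T (d_rho X)" "C1_rho T (d_t T X)"
    and mixed: "\<And>\<rho> s. s \<in> {0..T} \<Longrightarrow> d_t T (d_rho X) \<rho> s = d_rho (d_t T X) \<rho> s"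
    using reg by (auto simp: classical_regularity_def)
  have J: "continuous_on (UNIV \<times> {0..T}) (\<lambda>(\<rho>, s). d_rho X \<rho> s)"
    "continuous_on (UNIV \<times> {0..T}) (\<lambda>(\<rho>, s). d_t T X \<rho> s)"
    "continuous_on (UNIV \<times> {0..T}) (\<lambda>(\<rho>, s). d_rho (d_t T X) \<rho> s)"
    "continuous_on (UNIV \<times> {0..T}) (\<lambda>(\<rho>, s). X \<rho> s)"
    using C C1_imp_jointly_continuous[OF C(2,1)] by (auto simp: C1_rho_def C1_t_def)
  \<comment> \<open>The arc-length element cancels the denominator of the unit normal, leaving an
    expression without quotients to differentiate in time.\<close>
  have normal: "(v \<bullet> unit_normal X \<rho> s) * norm (d_rho X \<rho> s) = - (v \<bullet> perp (d_rho X \<rho> s))"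
    if "s \<in> {0..T}" for v \<rho> s
    using pos[OF that, of \<rho>]
    by (simp add: unit_normal_def d_s_def inner_perp field_simps)
  have area: "area X s = - 1/2 * integral {0..1} (\<lambda>\<rho>. X \<rho> s \<bullet> perp (d_rho X \<rho> s))"
    if "s \<in> {0..T}" for s
    by (simp add: area_def curve_integral_def normal[OF that])
  let ?h = "\<lambda>\<rho> s. X \<rho> s \<bullet> perp (d_rho (d_t T X) \<rho> s) + d_t T X \<rho> s \<bullet> perp (d_rho X \<rho> s)"
  have "((\<lambda>s. integral {0..1} (\<lambda>\<rho>. X \<rho> s \<bullet> perp (d_rho X \<rho> s))) has_real_derivative
      integral {0..1} (\<lambda>\<rho>. ?h \<rho> t)) (at t within {0..T})"
  proof (rule has_real_derivative_integral_parameter)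
    show "((\<lambda>s. X \<rho> s \<bullet> perp (d_rho X \<rho> s)) has_real_derivative ?h \<rho> s) (at s within {0..T})"
      if "s \<in> {0..T}" for \<rho> s
      using has_vector_derivative_inner_perp[OF C1_t_has_vector_derivative[OF C(1) that]
          C1_t_has_vector_derivative[OF C(3) that]]
      by (simp add: mixed[OF that] has_real_derivative_iff_has_vector_derivative)
    show "continuous_on {0..1} (\<lambda>\<rho>. X \<rho> s \<bullet> perp (d_rho X \<rho> s))" if "s \<in> {0..T}" for s
      by (intro continuous_intros C1_rho_continuous_d_rho[OF C(2) that]
          C1_rho_continuous[OF C(2) that])
    show "continuous_on (UNIV \<times> {0..T}) (\<lambda>(\<rho>, s). ?h \<rho> s)"
      using J unfolding case_prod_unfold by (intro continuous_intros)
  qed (rule t)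
  then have D: "((\<lambda>s. - 1/2 * integral {0..1} (\<lambda>\<rho>. X \<rho> s \<bullet> perp (d_rho X \<rho> s)))
      has_real_derivative - 1/2 * integral {0..1} (\<lambda>\<rho>. ?h \<rho> t)) (at t within {0..T})"
    by (rule DERIV_cmult)
  have "periodic1 (\<lambda>\<rho>. X \<rho> t \<bullet> perp (d_t T X \<rho> t))"
    using per[OF t] periodic1_d_t[of T X t, OF per t] by (simp add: periodic1_def)
  then have "((\<lambda>\<rho>. X \<rho> t \<bullet> perp (d_rho (d_t T X) \<rho> t) + d_rho X \<rho> t \<bullet> perp (d_t T X \<rho> t))
      has_integral 0) {0..1}"
    by (rule periodic1_has_integral_derivative)
       (intro has_vector_derivative_inner_perp C1_rho_has_vector_derivative[OF _ t] C)
  moreover have "(\<lambda>\<rho>. d_t T X \<rho> t \<bullet> perp (d_rho X \<rho> t)) integrable_on {0..1}"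
    by (intro integrable_continuous_interval continuous_intros
        C1_rho_continuous_d_rho[OF _ t] C1_rho_continuous[OF _ t] C)
  \<comment> \<open>By antisymmetry the second summand of the exact derivative is minus the term
    that is added twice, so the whole integrand equals \<open>?h\<close>.\<close>
  ultimately have "((\<lambda>\<rho>. (X \<rho> t \<bullet> perp (d_rho (d_t T X) \<rho> t) + d_rho X \<rho> t \<bullet> perp (d_t T X \<rho> t))
        + 2 * (d_t T X \<rho> t \<bullet> perp (d_rho X \<rho> t))) has_integral
      0 + 2 * integral {0..1} (\<lambda>\<rho>. d_t T X \<rho> t \<bullet> perp (d_rho X \<rho> t))) {0..1}"
    by (intro has_integral_add has_integral_mult_right integrable_integral)
  then have "integral {0..1} (\<lambda>\<rho>. ?h \<rho> t) =
      2 * integral {0..1} (\<lambda>\<rho>. d_t T X \<rho> t \<bullet> perp (d_rho X \<rho> t))"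
    by (subst (asm) inner_perp_commute[of "d_rho X _ t"]) (simp add: integral_unique algebra_simps)
  then have "- 1/2 * integral {0..1} (\<lambda>\<rho>. ?h \<rho> t) =
      curve_integral X (\<lambda>\<rho> t. d_t T X \<rho> t \<bullet> unit_normal X \<rho> t) t"
    by (simp add: curve_integral_def normal[OF t])
  with D have "((\<lambda>s. - 1/2 * integral {0..1} (\<lambda>\<rho>. X \<rho> s \<bullet> perp (d_rho X \<rho> s)))
      has_real_derivative curve_integral X (\<lambda>\<rho> t. d_t T X \<rho> t \<bullet> unit_normal X \<rho> t) t)
      (at t within {0..T})"
    by simp
  \<comment> \<open>The formula \<open>area\<close> holds on all of \<open>{0..T}\<close>, so the
    radius 1 of the neighbourhood is arbitrary.\<close>
  then show ?thesis
    by (rule has_field_derivative_transform_within[OF _ zero_less_one t]) (simp add: area)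
qed

section \<open>Vanishing of the multipliers\<close>

text \<open>One-sided derivatives at the endpoints are unique because the interval is nondegenerate;
  this is where \<open>T > 0\<close> enters.\<close>

lemma real_derivative_unique_Icc:
  fixes f :: "real \<Rightarrow> real"
  assumes "a < b" and "t \<in> {a..b}"
    and "(f has_real_derivative x) (at t within {a..b})"
    and "(f has_real_derivative y) (at t within {a..b})"
  shows "x = y"
  using vector_derivative_unique_within_closed_interval[of a b t f x y] assms
  by (simp add: has_real_derivative_iff_has_vector_derivative)

theorem proposition2p1:
  fixes T :: real
    and X :: "real \<Rightarrow> real \<Rightarrow> real^2"
    and \<kappa> :: "real \<Rightarrow> real \<Rightarrow> real"
    and \<mu> \<eta> :: "real \<Rightarrow> real"
  assumes "T > 0"
    and "classical_solution T X \<kappa> \<mu> \<eta>"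
  shows "\<forall>t\<in>{0..T}. \<not> (\<lambda>\<rho>. \<kappa> \<rho> t) constant_on UNIV \<longrightarrow> \<mu> t = 0 \<and> \<eta> t = 0"
proof (intro ballI impI)
  fix t assume t: "t \<in> {0..T}" and nonconst: "\<not> (\<lambda>\<rho>. \<kappa> \<rho> t) constant_on UNIV"
  note sol = assms(2)[unfolded classical_solution_def]
  have reg: "classical_regularity T X \<kappa>"
    and per: "\<And>s. s \<in> {0..T} \<Longrightarrow> periodic1 (\<lambda>\<rho>. X \<rho> s)"
    and pos: "\<And>\<rho> s. s \<in> {0..T} \<Longrightarrow> d_rho X \<rho> s \<noteq> 0"
    and per\<kappa>: "periodic1 (\<lambda>\<rho>. \<kappa> \<rho> t)"
    and velocity: "\<And>\<rho>. d_t T X \<rho> t \<bullet> unit_normal X \<rho> t = d_ss X \<kappa> \<rho> t + \<mu> t * \<kappa> \<rho> t + \<eta> t"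
    and curvature: "\<And>\<rho>. \<kappa> \<rho> t *\<^sub>R unit_normal X \<rho> t = - d_ss X X \<rho> t"
    and dL: "(perimeter X has_real_derivative
        - curve_integral X (\<lambda>\<rho> t. \<bar>d_s X \<kappa> \<rho> t\<bar>\<^sup>2) t) (at t within {0..T})"
    and dA: "(area X has_real_derivative 0) (at t within {0..T})"
    using sol t by (auto simp: evolving_closed_curve_def)
  have C: "C1_rho T X" "C1_rho T \<kappa>" "C1_rho T (d_s X \<kappa>)"
    using reg by (auto simp: classical_regularity_def)
  \<comment> \<open>Time is frozen from here on. \<open>g\<close> is the arc-length density: a
    spatial derivative is \<open>g\<close> times the arc-length derivative.\<close>
  define g where "g \<rho> = norm (d_rho X \<rho> t)" for \<rho>
  define k where "k \<rho> = \<kappa> \<rho> t" for \<rho>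
  define ks where "ks \<rho> = d_s X \<kappa> \<rho> t" for \<rho>
  define kss where "kss \<rho> = d_ss X \<kappa> \<rho> t" for \<rho>
  define w where "w \<rho> = \<mu> t * k \<rho> + \<eta> t" for \<rho>
  have g_pos: "g \<rho> > 0" for \<rho>
    using pos[OF t] by (simp add: g_def)
  have deriv_k: "(k has_vector_derivative ks \<rho> * g \<rho>) (at \<rho>)" for \<rho>
    using C1_rho_has_vector_derivative[OF C(2) t, of \<rho>] g_pos[of \<rho>]
    by (simp add: k_def [abs_def] ks_def g_def d_s_def field_simps)
  have deriv_ks: "(ks has_vector_derivative kss \<rho> * g \<rho>) (at \<rho>)" for \<rho>
    using C1_rho_has_vector_derivative[OF C(3) t, of \<rho>] g_pos[of \<rho>]
    by (simp add: ks_def [abs_def] kss_def g_def d_ss_def d_s_def[of X "d_s X \<kappa>"] field_simps)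
  have per_ks: "periodic1 ks"
    using periodic1_d_s[of X t \<kappa>, OF per[OF t] per\<kappa>] by (simp add: ks_def [abs_def])
  have cont_g: "continuous_on {0..1} g"
    unfolding g_def by (intro continuous_intros C1_rho_continuous_d_rho[OF C(1) t])
  have cont_k: "continuous_on {0..1} k"
    unfolding k_def by (rule C1_rho_continuous[OF C(2) t])
  have cont_ks: "continuous_on {0..1} ks"
    unfolding ks_def by (rule C1_rho_continuous[OF C(3) t])
  have cont_w: "continuous_on {0..1} w"
    unfolding w_def by (intro continuous_intros cont_k)

  have int_kss: "((\<lambda>\<rho>. kss \<rho> * g \<rho>) has_integral 0) {0..1}"
    by (rule periodic1_has_integral_derivative[OF per_ks deriv_ks])
  \<comment> \<open>The integrand is the derivative of \<open>k * ks\<close>, so the integral of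
    \<open>k * kss\<close> along the curve is minus that of the square of \<open>ks\<close>.\<close>
  have int_k_kss: "((\<lambda>\<rho>. k \<rho> * (kss \<rho> * g \<rho>) + (ks \<rho> * g \<rho>) * ks \<rho>) has_integral 0) {0..1}"
  proof (rule periodic1_has_integral_derivative)
    show "periodic1 (\<lambda>\<rho>. k \<rho> * ks \<rho>)"
      using per_ks per\<kappa> by (simp add: periodic1_def k_def)
    show "((\<lambda>\<rho>. k \<rho> * ks \<rho>) has_vector_derivative k \<rho> * (kss \<rho> * g \<rho>) + (ks \<rho> * g \<rho>) * ks \<rho>)
        (at \<rho>)" for \<rho>
      by (rule has_vector_derivative_mult[OF deriv_k deriv_ks])
  qed

  have "curve_integral X (\<lambda>\<rho> t. d_t T X \<rho> t \<bullet> unit_normal X \<rho> t) t = 0"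
    by (rule real_derivative_unique_Icc[OF assms(1) t area_has_real_derivative[OF reg per pos t] dA])
  then have V: "integral {0..1} (\<lambda>\<rho>. kss \<rho> * g \<rho> + w \<rho> * g \<rho>) = 0"
    by (simp add: curve_integral_def velocity kss_def g_def w_def k_def algebra_simps)
  have int_w: "((\<lambda>\<rho>. w \<rho> * g \<rho>) has_integral 0) {0..1}"
  proof -
    have I: "((\<lambda>\<rho>. w \<rho> * g \<rho>) has_integral integral {0..1} (\<lambda>\<rho>. w \<rho> * g \<rho>)) {0..1}"
      by (intro integrable_integral integrable_continuous_interval continuous_intros cont_w cont_g)
    from integral_unique[OF has_integral_add[OF int_kss I]] V I show ?thesis by simp
  qed

  \<comment> \<open>The derivative of the tangent is normal to the curve by the curvature equation.
    Hence only the normal velocity, which the system prescribes, contributes; the tangential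
    velocity drops out.\<close>
  have tangent_deriv: "d_rho (d_s X X) \<rho> t \<bullet> d_t T X \<rho> t =
      - (k \<rho> * (kss \<rho> * g \<rho>)) - k \<rho> * (w \<rho> * g \<rho>)" for \<rho>
  proof -
    have "d_rho (d_s X X) \<rho> t = g \<rho> *\<^sub>R d_ss X X \<rho> t"
      using g_pos[of \<rho>] by (simp add: d_ss_def d_s_def[of X "d_s X X"] g_def)
    also have "\<dots> = - ((g \<rho> * k \<rho>) *\<^sub>R unit_normal X \<rho> t)"
      using curvature[of \<rho>] by (simp add: k_def flip: scaleR_scaleR)
    finally have "d_rho (d_s X X) \<rho> t \<bullet> d_t T X \<rho> t =
        - (g \<rho> * k \<rho> * (d_t T X \<rho> t \<bullet> unit_normal X \<rho> t))"
      by (simp add: inner_commute)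
    then show ?thesis
      by (simp add: velocity kss_def w_def k_def algebra_simps)
  qed
  have "integral {0..1} (\<lambda>\<rho>. d_rho (d_s X X) \<rho> t \<bullet> d_t T X \<rho> t) =
      curve_integral X (\<lambda>\<rho> t. \<bar>d_s X \<kappa> \<rho> t\<bar>\<^sup>2) t"
    using real_derivative_unique_Icc[OF assms(1) t perimeter_has_real_derivative[OF reg per pos t] dL]
    by simp
  then have P: "integral {0..1} (\<lambda>\<rho>. - (k \<rho> * (kss \<rho> * g \<rho>)) - k \<rho> * (w \<rho> * g \<rho>)) =
      integral {0..1} (\<lambda>\<rho>. (ks \<rho> * g \<rho>) * ks \<rho>)"
    by (simp add: tangent_deriv curve_integral_def ks_def g_def power2_eq_square algebra_simps)
  have int_kw: "((\<lambda>\<rho>. k \<rho> * (w \<rho> * g \<rho>)) has_integral 0) {0..1}"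
  proof -
    have I: "((\<lambda>\<rho>. k \<rho> * (w \<rho> * g \<rho>)) has_integral integral {0..1} (\<lambda>\<rho>. k \<rho> * (w \<rho> * g \<rho>))) {0..1}"
      and K: "((\<lambda>\<rho>. (ks \<rho> * g \<rho>) * ks \<rho>) has_integral
        integral {0..1} (\<lambda>\<rho>. (ks \<rho> * g \<rho>) * ks \<rho>)) {0..1}"
      by (intro integrable_integral integrable_continuous_interval continuous_intros
          cont_w cont_g cont_k cont_ks)+
    \<comment> \<open>Subtracting the exact derivative from \<open>K\<close> leaves
      \<open>- k * kss * g\<close>; subtracting \<open>I\<close> then produces the integrand on the
      left of \<open>P\<close>. The two values of its integral differ by the integral of
      \<open>k * w * g\<close>, which must therefore vanish.\<close>
    from integral_unique[OF has_integral_diff[OF has_integral_diff[OF K int_k_kss] I]] P I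
    show ?thesis by simp
  qed

  \<comment> \<open>The weights \<open>\<mu> t\<close> and \<open>\<eta> t\<close> are chosen to
    rebuild one factor \<open>w\<close>, giving a square.\<close>
  have "((\<lambda>\<rho>. \<mu> t * (k \<rho> * (w \<rho> * g \<rho>)) + \<eta> t * (w \<rho> * g \<rho>)) has_integral \<mu> t * 0 + \<eta> t * 0) {0..1}"
    by (intro has_integral_add has_integral_mult_right int_kw int_w)
  moreover have "\<mu> t * (k \<rho> * (w \<rho> * g \<rho>)) + \<eta> t * (w \<rho> * g \<rho>) = (w \<rho>)\<^sup>2 * g \<rho>" for \<rho>
    by (simp add: w_def power2_eq_square algebra_simps)
  ultimately have "integral {0..1} (\<lambda>\<rho>. (w \<rho>)\<^sup>2 * g \<rho>) = 0"
    by (simp add: integral_unique)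
  \<comment> \<open>A continuous nonnegative function with zero integral vanishes at every
    point.\<close>
  then have "\<forall>\<rho>\<in>{0..1}. (w \<rho>)\<^sup>2 * g \<rho> = 0"
    using g_pos by (subst (asm) integral_eq_0_iff)
      (auto intro!: continuous_intros cont_w cont_g simp: less_imp_le)
  \<comment> \<open>Only one period is covered so far; the fractional part and the periodicity of
    \<open>\<kappa>\<close> extend the vanishing to the whole line, where nonconstancy is
    stated.\<close>
  then have "w (frac \<rho>) = 0" for \<rho>
    using g_pos[of "frac \<rho>"] frac_ge_0[of \<rho>] frac_lt_1[of \<rho>] by fastforce
  then have w_zero: "\<mu> t * \<kappa> \<rho> t + \<eta> t = 0" for \<rho>
    by (simp add: w_def k_def periodic1_frac[OF per\<kappa>])
  have "\<mu> t = 0"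
  proof (rule ccontr)
    assume "\<mu> t \<noteq> 0"
    then have "\<kappa> \<rho> t = - \<eta> t / \<mu> t" for \<rho>
      using w_zero[of \<rho>] by (simp add: field_simps)
    with nonconst show False
      by (auto simp: constant_on_def)
  qed
  with w_zero show "\<mu> t = 0 \<and> \<eta> t = 0" by simp
qed

end
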